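(* Let $G$ be a connected bipartite graph of order $n\geq 4$. If $\delta(G)\geq \frac{n+6}{8}$, then $pc(G)=2$.
   Context: All graphs are finite, simple and undirected; $\delta(G)$ is the minimum degree. In an edge-colored graph, a path is a proper path if no two adjacent (consecutive) edges of the path receive the same color. For a connected graph $G$, the proper connection number $pc(G)$ is the minimum number of colors in an edge-coloring of $G$ (adjacent edges may share colors) such that every pair of distinct vertices of $G$ is joined by at least one proper path. *)

theory Defs
  imports Complex_Main
begin

definition simple_graph :: "'a set \<Rightarrow> 'a set set \<Rightarrow> bool" where
  "simple_graph V E \<longleftrightarrow> finite V \<and> (\<forall>e\<in>E. e \<subseteq> V \<and> card e = 2)"

definition degree :: "'a set set \<Rightarrow> 'a \<Rightarrow> nat" where
  "degree E v = card {e \<in> E. v \<in> e}"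

definition min_degree :: "'a set \<Rightarrow> 'a set set \<Rightarrow> nat" where
  "min_degree V E = Min (degree E ` V)"

definition bipartite :: "'a set \<Rightarrow> 'a set set \<Rightarrow> bool" where
  "bipartite V E \<longleftrightarrow>
     (\<exists>X Y. X \<union> Y = V \<and> X \<inter> Y = {} \<and> (\<forall>e\<in>E. \<exists>x\<in>X. \<exists>y\<in>Y. e = {x, y}))"

text \<open>A path is represented by the list of its vertices; the edges are listed in order of traversal.\<close>

definition path_edges :: "'a list \<Rightarrow> 'a set list" where
  "path_edges p = map2 (\<lambda>u v. {u, v}) p (tl p)"

definition is_path :: "'a set \<Rightarrow> 'a set set \<Rightarrow> 'a \<Rightarrow> 'a list \<Rightarrow> 'a \<Rightarrow> bool" where
  "is_path V E u p v \<longleftrightarrow>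
     p \<noteq> [] \<and> hd p = u \<and> last p = v \<and> distinct p \<and> set p \<subseteq> V \<and> set (path_edges p) \<subseteq> E"

definition connected_graph :: "'a set \<Rightarrow> 'a set set \<Rightarrow> bool" where
  "connected_graph V E \<longleftrightarrow> V \<noteq> {} \<and> (\<forall>u\<in>V. \<forall>v\<in>V. \<exists>p. is_path V E u p v)"

definition proper_path ::
    "'a set \<Rightarrow> 'a set set \<Rightarrow> ('a set \<Rightarrow> 'c) \<Rightarrow> 'a \<Rightarrow> 'a list \<Rightarrow> 'a \<Rightarrow> bool" where
  "proper_path V E c u p v \<longleftrightarrow>
     is_path V E u p v \<and> successively (\<lambda>e f. c e \<noteq> c f) (path_edges p)"

definition proper_connected_coloring ::
    "'a set \<Rightarrow> 'a set set \<Rightarrow> ('a set \<Rightarrow> 'c) \<Rightarrow> bool" where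
  "proper_connected_coloring V E c \<longleftrightarrow>
     (\<forall>u\<in>V. \<forall>v\<in>V. u \<noteq> v \<longrightarrow> (\<exists>p. proper_path V E c u p v))"

text \<open>Only meaningful for a finite connected graph, where an injective coloring shows that the
  minimum exists.\<close>

definition proper_connection_number :: "'a set \<Rightarrow> 'a set set \<Rightarrow> nat" where
  "proper_connection_number V E =
     (LEAST k. \<exists>c :: 'a set \<Rightarrow> nat. card (c ` E) = k \<and> proper_connected_coloring V E c)"

end

theory Submission
  imports Defs
begin

text \<open>
  Orient an edge of colour 0 from the class X to the class Y and an edge of colour 1 from Y to X.
  Then a path of a bipartite graph is proper iff it is directed in one of its two directions, so a
  proper connected 2-colouring is the same as a unilateral orientation. A maximal set that admits
  a strong orientation cannot be extended by an ear, so all edges leaving it are bridges. A vertex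
  set with fewer than \<open>d\<close> leaving edges, where \<open>d\<close> is the minimum degree, has at least \<open>2d\<close>
  vertices; since \<open>n + 6 \<le> 8d\<close>, there is no room for a strong part with three
  branches. Hence the strong parts are arranged along a path, and orienting all bridges along this
  path gives a unilateral orientation.
\<close>

section \<open>Directed walks, simple paths and their arcs\<close>

lemma rtrancl_imp_distinct_path:
  assumes "(u, v) \<in> R\<^sup>*"
  shows "\<exists>p. p \<noteq> [] \<and> hd p = u \<and> last p = v \<and> distinct p \<and> successively (\<lambda>a b. (a, b) \<in> R) p"
  using assms
proof (induction rule: rtrancl_induct)
  case base
  show ?case by (rule exI[of _ "[u]"]) simp
next
  case (step v w)
  then obtain p where p: "p \<noteq> []" "hd p = u" "last p = v" "distinct p"
    "successively (\<lambda>a b. (a, b) \<in> R) p" by blast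
  show ?case
  proof (cases "w \<in> set p")
    case True
    \<comment> \<open>A walk that returns to a visited vertex is cut back to the prefix ending
      there.\<close>
    then obtain q r where q: "p = q @ w # r" by (meson split_list)
    have "hd (q @ [w]) = u" using p(2) q by (cases q) auto
    with p q show ?thesis
      by (intro exI[of _ "q @ [w]"]) (auto simp: successively_append_iff)
  next
    case False
    with p step show ?thesis
      by (intro exI[of _ "p @ [w]"]) (auto simp: successively_append_iff)
  qed
qed

definition arcs :: "'a list \<Rightarrow> ('a \<times> 'a) set" where
  "arcs p = set (zip p (tl p))"

lemma arcs_simps [simp]:
  "arcs [] = {}" "arcs [a] = {}" "arcs (a # b # p) = insert (a, b) (arcs (b # p))"
  by (simp_all add: arcs_def)

lemma arcs_subset: "arcs p \<subseteq> set p \<times> set p"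
  by (induction p rule: induct_list012) auto

lemma arcs_subset_if_successively:
  "successively (\<lambda>a b. (a, b) \<in> R) p \<Longrightarrow> arcs p \<subseteq> R"
  by (induction p rule: induct_list012) auto

text \<open>The head of a simple path does not recur, so no later arc can reverse the first one.
  Hence such a path is itself an orientation of its edges.\<close>

lemma arcs_asym: "distinct p \<Longrightarrow> (a, b) \<in> arcs p \<Longrightarrow> (b, a) \<notin> arcs p"
proof (induction p rule: induct_list012)
  case (3 x y p)
  then show ?case using arcs_subset[of "y # p"] by auto
qed auto

lemma hd_reaches_along_arcs: "z \<in> set p \<Longrightarrow> (hd p, z) \<in> (arcs p)\<^sup>*"
proof (induction p rule: induct_list012)
  case (3 x y p)
  show ?case
  proof (cases "z = x")
    case False
    then have "(y, z) \<in> (arcs (y # p))\<^sup>*" using 3 by auto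
    then have "(y, z) \<in> (arcs (x # y # p))\<^sup>*"
      by (rule rtrancl_mono[THEN subsetD, rotated]) auto
    then show ?thesis by (auto intro: converse_rtrancl_into_rtrancl)
  qed auto
qed auto

lemma reaches_last_along_arcs: "z \<in> set p \<Longrightarrow> (z, last p) \<in> (arcs p)\<^sup>*"
proof (induction p arbitrary: z rule: induct_list012)
  case (3 x y p)
  have "(arcs (y # p))\<^sup>* \<subseteq> (arcs (x # y # p))\<^sup>*" by (rule rtrancl_mono) auto
  then have IH: "(w, last (y # p)) \<in> (arcs (x # y # p))\<^sup>*" if "w \<in> set (y # p)" for w
    using "3.IH"(2)[OF that] by blast
  have "(x, last (y # p)) \<in> (arcs (x # y # p))\<^sup>*"
    by (rule converse_rtrancl_into_rtrancl[OF _ IH[of y]]) auto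
  then show ?case using IH[of z] "3.prems" by (cases "z = x") auto
qed auto

lemma rtrancl_in_if_closed:
  assumes "(u, v) \<in> R\<^sup>*" "u \<in> S" "\<And>a b. a \<in> S \<Longrightarrow> (a, b) \<in> R \<Longrightarrow> b \<in> S"
  shows "v \<in> S"
  using assms by (induction rule: rtrancl_induct) auto

section \<open>Edge counting in bipartite graphs of large minimum degree\<close>

lemma four_mult_le_sum_square: "4 * (a * b) \<le> (a + b) * (a + b :: int)"
  using zero_le_square[of "a - b"] by (simp add: algebra_simps)

lemma card_three_disjoint_le:
  assumes "finite C" "A \<subseteq> C" "B \<subseteq> C" "S \<subseteq> C" "A \<inter> B = {}" "A \<inter> S = {}" "B \<inter> S = {}"
  shows "card A + card B + card S \<le> card C"
proof -
  have fin: "finite A" "finite B" "finite S" using assms finite_subset by blast+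
  then have "card A + card B + card S = card (A \<union> B \<union> S)"
    using assms(5-7) by (simp add: card_Un_disjoint Int_Un_distrib2)
  also have "\<dots> \<le> card C" using assms by (intro card_mono) auto
  finally show ?thesis .
qed

text \<open>The graph enters as its symmetric adjacency relation, so that orientations are subsets
  of \<open>R\<close> and walks are reflexive transitive closures.\<close>

locale dense_bipartite =
  fixes V X Y :: "'a set" and R :: "('a \<times> 'a) set" and d :: nat
  assumes finite_V: "finite V"
    and sym_R: "(u, v) \<in> R \<Longrightarrow> (v, u) \<in> R"
    and parts: "X \<union> Y = V" "X \<inter> Y = {}"
    and R_between: "R \<subseteq> X \<times> Y \<union> Y \<times> X"
    and connected: "u \<in> V \<Longrightarrow> v \<in> V \<Longrightarrow> (u, v) \<in> R\<^sup>*"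
    and degree_ge: "v \<in> V \<Longrightarrow> d \<le> card (R `` {v})"
    and card_V_ge: "4 \<le> card V"
    and d_ge: "card V + 6 \<le> 8 * d"
begin

lemma R_V: "R \<subseteq> V \<times> V"
  using R_between parts by auto

lemma finite_R: "finite R"
  by (rule finite_subset[of _ "V \<times> V"]) (use R_V finite_V in auto)

lemma R_irrefl: "(u, u) \<notin> R"
  using R_between parts by auto

text \<open>Each crossing edge is recorded once, as the pair pointing outwards. A singleton boundary
  thus describes a bridge, with its inner end first.\<close>

definition boundary :: "'a set \<Rightarrow> ('a \<times> 'a) set" where
  "boundary S = R \<inter> S \<times> (- S)"

lemma finite_boundary: "finite (boundary S)"
  using finite_R by (simp add: boundary_def)

lemma boundary_nonempty:
  assumes "S \<subseteq> V" "S \<noteq> {}" "S \<noteq> V"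
  shows "boundary S \<noteq> {}"
proof
  assume "boundary S = {}"
  obtain u v where "u \<in> S" "v \<in> V" "v \<notin> S" using assms by blast
  then show False
    using rtrancl_in_if_closed[of u v R S] connected[of u v] assms \<open>boundary S = {}\<close>
    by (auto simp: boundary_def)
qed

text \<open>At least \<open>card S * d\<close> pairs of \<open>R\<close> start in \<open>S\<close>,
  but bipartiteness allows at most \<open>2 * card A * card B\<close>, hence at most half the square
  of \<open>card S\<close>, to stay inside. If \<open>card S < 2 * d\<close>, the surplus forces at
  least \<open>d\<close> pairs to leave \<open>S\<close>.\<close>

lemma card_ge_if_small_boundary:
  assumes "S \<subseteq> V" "S \<noteq> {}" "card (boundary S) < d"
  shows "2 * d \<le> card S"
proof -
  have fin: "finite S" using assms finite_V finite_subset by blast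
  define A where "A = S \<inter> X"
  define B where "B = S \<inter> Y"
  have finAB: "finite A" "finite B" using fin by (auto simp: A_def B_def)
  have "S = A \<union> B" "A \<inter> B = {}" using assms parts by (auto simp: A_def B_def)
  then have cardS: "card S = card A + card B" using finAB by (simp add: card_Un_disjoint)
  have "card S * d \<le> (\<Sum>x\<in>S. card (R `` {x}))"
    using sum_mono[of S "\<lambda>_. d" "\<lambda>x. card (R `` {x})"] degree_ge assms by auto
  also have "\<dots> = card (SIGMA x:S. R `` {x})"
    by (subst card_SigmaI) (use fin finite_R in auto)
  also have "\<dots> \<le> card (A \<times> B \<union> B \<times> A \<union> boundary S)"
    by (rule card_mono) (use finAB finite_boundary R_between in \<open>auto simp: A_def B_def boundary_def\<close>)
  also have "\<dots> \<le> card (A \<times> B) + card (B \<times> A) + card (boundary S)"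
    by (meson add_le_mono card_Un_le le_trans order_refl)
  finally have count: "card S * d \<le> 2 * (card A * card B) + card (boundary S)"
    by (simp add: card_cartesian_product mult.commute)
  show ?thesis
  proof (rule ccontr)
    assume "\<not> 2 * d \<le> card S"
    moreover have "1 \<le> card S" using assms fin by (simp add: Suc_leI card_gt_0_iff)
    \<comment> \<open>For \<open>s\<close> from 1 to \<open>2 * d - 1\<close> the concave function
      \<open>s * (2 * d - s)\<close> is at least \<open>2 * d - 1\<close>, its value at both ends;
      the product is the difference.\<close>
    ultimately have "0 \<le> (int (card S) - 1) * (2 * int d - 1 - int (card S))"
      by (intro mult_nonneg_nonneg) linarith+
    then have "2 * int d - 1 \<le> int (card S) * (2 * int d) - int (card S) * int (card S)"
      by (simp add: algebra_simps)
    moreover have "4 * (int (card A) * int (card B)) \<le> int (card S) * int (card S)"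
      using four_mult_le_sum_square[of "int (card A)" "int (card B)"] by (simp add: cardS)
    moreover have "int (card S) * int d \<le> 2 * (int (card A) * int (card B)) + int (card (boundary S))"
      using count by (metis of_nat_add of_nat_le_iff of_nat_mult of_nat_numeral)
    ultimately show False using assms(3) by linarith
  qed
qed

section \<open>Partial orientations and their extension by ears\<close>

definition orientation :: "'a set \<Rightarrow> ('a \<times> 'a) set \<Rightarrow> bool" where
  "orientation S D \<longleftrightarrow> D \<subseteq> R \<inter> S \<times> S \<and> D \<inter> D\<inverse> = {}"

lemma orientation_insert:
  assumes "orientation S D" "x \<in> S" "y \<in> S" "(x, y) \<in> R" "(y, x) \<notin> D"
  shows "orientation S (insert (x, y) D)"
  using assms R_irrefl by (auto simp: orientation_def)

lemma orientation_converse: "orientation S D \<Longrightarrow> orientation S (D\<inverse>)"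
  using sym_R by (auto simp: orientation_def)

lemma orientation_Un:
  assumes D: "orientation S D" and D': "orientation S' D'" and "S \<inter> S' = {}"
  shows "orientation (S \<union> S') (D \<union> D')"
proof -
  have "D \<subseteq> R \<inter> S \<times> S" "D' \<subseteq> R \<inter> S' \<times> S'" "D \<inter> D\<inverse> = {}" "D' \<inter> D'\<inverse> = {}"
    using D D' by (auto simp: orientation_def)
  moreover from this have "D \<inter> D'\<inverse> = {}" "D' \<inter> D\<inverse> = {}" using assms(3) by blast+
  ultimately show ?thesis unfolding orientation_def by blast
qed

lemma orientation_join:
  assumes "orientation S D" "orientation S' D'" "S \<inter> S' = {}" "x \<in> S" "y \<in> S'" "(x, y) \<in> R"
  shows "orientation (S \<union> S') (insert (x, y) (D \<union> D'))"
proof (rule orientation_insert)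
  show "orientation (S \<union> S') (D \<union> D')" by (rule orientation_Un) (use assms in auto)
  have "D \<subseteq> S \<times> S" "D' \<subseteq> S' \<times> S'" using assms(1,2) by (auto simp: orientation_def)
  then show "(y, x) \<notin> D \<union> D'" using assms(3-5) by blast
qed (use assms in auto)

text \<open>Strong connectivity is expressed through a root: any two vertices are joined by way of
  \<open>t\<close>.\<close>

definition strongly_orientable :: "'a \<Rightarrow> 'a set \<Rightarrow> bool" where
  "strongly_orientable t S \<longleftrightarrow> t \<in> S \<and> S \<subseteq> V \<and>
     (\<exists>D. orientation S D \<and> (\<forall>z\<in>S. (t, z) \<in> D\<^sup>* \<and> (z, t) \<in> D\<^sup>*))"

text \<open>The root must reach all of \<open>S\<close> so that an arc entering \<open>S\<close> at
  \<open>t\<close> makes the whole of \<open>S\<close> reachable.\<close>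

definition unilaterally_orientable :: "'a \<Rightarrow> 'a set \<Rightarrow> bool" where
  "unilaterally_orientable t S \<longleftrightarrow>
     (\<exists>D. orientation S D \<and> (\<forall>z\<in>S. (t, z) \<in> D\<^sup>*) \<and>
       (\<forall>u\<in>S. \<forall>v\<in>S. (u, v) \<in> D\<^sup>* \<or> (v, u) \<in> D\<^sup>*))"

lemma unilaterally_orientable_if_strongly:
  assumes "strongly_orientable t S"
  shows "unilaterally_orientable t S"
  using assms unfolding strongly_orientable_def unilaterally_orientable_def
  by (meson rtrancl_trans)

text \<open>The ear leaves \<open>T\<close> by \<open>(x, y)\<close>, follows a simple path in
  \<open>W\<close> and returns by \<open>(y', x')\<close>. Either \<open>x = x'\<close> or
  \<open>y = y'\<close> may hold, but \<open>ne\<close> keeps one edge from being used in both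
  directions. Only the vertices of the path are added.\<close>

lemma strongly_orientable_add_ear:
  assumes T: "strongly_orientable t T"
    and x: "x \<in> T" "(x, y) \<in> R" and x': "x' \<in> T" "(y', x') \<in> R"
    and W: "W \<subseteq> V" "W \<inter> T = {}" "y \<in> W"
    and yy': "(y, y') \<in> (R \<inter> W \<times> W)\<^sup>*"
    and ne: "(x, y) \<noteq> (x', y')"
  shows "\<exists>T'. strongly_orientable t T' \<and> T \<subset> T' \<and> T' \<subseteq> T \<union> W"
proof -
  obtain D where D: "orientation T D" "\<And>z. z \<in> T \<Longrightarrow> (t, z) \<in> D\<^sup>* \<and> (z, t) \<in> D\<^sup>*"
    and t: "t \<in> T" "T \<subseteq> V"
    using T by (auto simp: strongly_orientable_def)
  obtain p where p: "p \<noteq> []" "hd p = y" "last p = y'" "distinct p"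
    "successively (\<lambda>a b. (a, b) \<in> R \<inter> W \<times> W) p"
    using rtrancl_imp_distinct_path[OF yy'] by blast
  have arcs_p: "arcs p \<subseteq> R \<inter> W \<times> W" by (rule arcs_subset_if_successively[OF p(5)])
  have hd_in: "y \<in> set p" "y' \<in> set p" using p by (auto simp flip: p(2,3))
  have pW: "set p \<subseteq> W"
  proof
    fix z assume "z \<in> set p"
    then have "(y, z) \<in> (arcs p)\<^sup>*" using hd_reaches_along_arcs p(2) by metis
    then show "z \<in> W" by (rule rtrancl_in_if_closed) (use W(3) arcs_p in auto)
  qed
  define D' where "D' = insert (y', x') (insert (x, y) (D \<union> arcs p))"
  have pT: "T \<inter> set p = {}" using pW W by auto
  have "orientation (set p) (arcs p)"
    using arcs_p arcs_subset arcs_asym[OF p(4)] by (fastforce simp: orientation_def)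
  then have join: "orientation (T \<union> set p) (insert (x, y) (D \<union> arcs p))"
    using D(1) pT x hd_in by (intro orientation_join) auto
  have "D \<subseteq> T \<times> T" using D(1) by (auto simp: orientation_def)
  moreover have "y \<notin> T" "y' \<notin> T" "x \<notin> set p" "x' \<notin> set p" using x x' hd_in pT by blast+
  \<comment> \<open>Among the arcs chosen so far only \<open>(x, y)\<close> leads from
    \<open>T\<close> to the path, so the returning arc reverses none of them.\<close>
  ultimately have "(x', y') \<notin> insert (x, y) (D \<union> arcs p)"
    using arcs_subset[of p] ne by blast
  then have "orientation (T \<union> set p) D'"
    unfolding D'_def using x x' hd_in by (intro orientation_insert[OF join]) auto
  moreover have "(t, z) \<in> D'\<^sup>* \<and> (z, t) \<in> D'\<^sup>*" if "z \<in> T \<union> set p" for z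
  proof -
    have mono: "D\<^sup>* \<subseteq> D'\<^sup>*" "(arcs p)\<^sup>* \<subseteq> D'\<^sup>*"
      by (rule rtrancl_mono; auto simp: D'_def)+
    have tx: "(t, x) \<in> D'\<^sup>*" and x't: "(x', t) \<in> D'\<^sup>*" using D(2) x x' mono by auto
    have arc: "(x, y) \<in> D'" "(y', x') \<in> D'" by (auto simp: D'_def)
    show ?thesis
    proof (cases "z \<in> T")
      case True
      then show ?thesis using D(2) mono by auto
    next
      case False
      then have "(y, z) \<in> D'\<^sup>*" "(z, y') \<in> D'\<^sup>*"
        using that hd_reaches_along_arcs[of z p] reaches_last_along_arcs[of z p] mono p(2,3)
        by auto
      then show ?thesis using tx x't arc
        by (meson converse_rtrancl_into_rtrancl rtrancl_trans)
    qed
  qed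
  ultimately have "strongly_orientable t (T \<union> set p)"
    using t pW W unfolding strongly_orientable_def by blast
  then show ?thesis using pW W hd_in by (intro exI[of _ "T \<union> set p"]) auto
qed

section \<open>Branches: the connected components left outside a maximal strong part\<close>

definition branch :: "'a set \<Rightarrow> 'a \<Rightarrow> 'a set" where
  "branch W y = {z. (y, z) \<in> (R \<inter> W \<times> W)\<^sup>*}"

lemma branch_subset: "y \<in> W \<Longrightarrow> branch W y \<subseteq> W"
  by (auto simp: branch_def elim: rtranclE)

lemma branch_eq_if_meet:
  assumes "branch W y \<inter> branch W z \<noteq> {}"
  shows "branch W y = branch W z"
proof -
  have "sym ((R \<inter> W \<times> W)\<^sup>*)" by (rule sym_rtrancl) (auto intro!: symI sym_R)
  then show ?thesis using assms unfolding branch_def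
    by (auto dest: symD intro: rtrancl_trans; meson rtrancl_trans symD)
qed

text \<open>Extensions are confined to \<open>C\<close> because the later induction works on one
  side of a bridge.\<close>

definition maximal_strong :: "'a set \<Rightarrow> 'a \<Rightarrow> 'a set \<Rightarrow> bool" where
  "maximal_strong C t T \<longleftrightarrow> strongly_orientable t T \<and> T \<subseteq> C \<and>
     (\<forall>T'. strongly_orientable t T' \<and> T \<subset> T' \<longrightarrow> \<not> T' \<subseteq> C)"

lemma maximal_strong_exists:
  assumes "t \<in> C" "C \<subseteq> V"
  shows "\<exists>T. maximal_strong C t T"
proof -
  define F where "F = {T. strongly_orientable t T \<and> T \<subseteq> C}"
  have "strongly_orientable t {t}"
    using assms by (auto simp: strongly_orientable_def orientation_def intro: exI[of _ "{}"])
  then have "{t} \<in> F" using assms by (auto simp: F_def)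
  moreover have "finite F"
    by (rule finite_subset[of _ "Pow V"]) (use assms finite_V in \<open>auto simp: F_def\<close>)
  ultimately obtain T where "T \<in> F" "\<forall>T'\<in>F. T \<subseteq> T' \<longrightarrow> T = T'"
    using finite_has_maximal[of F] by auto
  then show ?thesis unfolding maximal_strong_def F_def by blast
qed

text \<open>A component has no edge to the rest of \<open>C - T\<close>, and edges leaving
  \<open>C\<close> start at \<open>t\<close>, which is in \<open>T\<close>. A second edge back to
  \<open>T\<close>, together with a walk through the component, would be an ear inside
  \<open>C\<close>, against maximality.\<close>

lemma boundary_branch:
  assumes T: "maximal_strong C t T" and C: "C \<subseteq> V" "boundary C \<subseteq> {t} \<times> UNIV"
    and x: "x \<in> T" "(x, y) \<in> R" "y \<in> C - T"
  shows "boundary (branch (C - T) y) = {(y, x)}"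
proof
  let ?K = "branch (C - T) y"
  have K: "?K \<subseteq> C - T" by (rule branch_subset) (rule x)
  have y: "y \<in> ?K" by (simp add: branch_def)
  have tT: "t \<in> T" using T by (auto simp: maximal_strong_def strongly_orientable_def)
  show "{(y, x)} \<subseteq> boundary ?K" using x y K by (auto simp: boundary_def intro: sym_R)
  show "boundary ?K \<subseteq> {(y, x)}"
  proof
    fix e assume "e \<in> boundary ?K"
    then obtain y' x' where e: "e = (y', x')" "(y', x') \<in> R" "y' \<in> ?K" "x' \<notin> ?K"
      by (auto simp: boundary_def)
    have "x' \<in> C"
    proof (rule ccontr)
      assume "x' \<notin> C"
      then have "(y', x') \<in> boundary C" using e K by (auto simp: boundary_def)
      then show False using C e K tT by auto
    qed
    moreover have "x' \<notin> C - T"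
    proof
      assume "x' \<in> C - T"
      then have "(y', x') \<in> R \<inter> (C - T) \<times> (C - T)" using e K by auto
      then show False using e by (auto simp: branch_def dest: rtrancl_into_rtrancl)
    qed
    ultimately have "x' \<in> T" by auto
    show "e \<in> {(y, x)}"
    proof (rule ccontr)
      assume "e \<notin> {(y, x)}"
      then have "\<exists>T'. strongly_orientable t T' \<and> T \<subset> T' \<and> T' \<subseteq> T \<union> (C - T)"
        using T C x e \<open>x' \<in> T\<close>
        by (intro strongly_orientable_add_ear[of t T x y x' y' "C - T"])
          (auto simp: maximal_strong_def branch_def)
      moreover have "T \<union> (C - T) = C" using T by (auto simp: maximal_strong_def)
      ultimately show False using T by (metis maximal_strong_def)
    qed
  qed
qed

text \<open>The bounds on \<open>card V\<close> give \<open>2 \<le> d\<close>, so a single leaving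
  edge is fewer than \<open>d\<close>.\<close>

lemma card_ge_if_bridge:
  assumes "S \<subseteq> V" "S \<noteq> {}" "boundary S = {e}"
  shows "2 * d \<le> card S"
  using card_ge_if_small_boundary[of S] assms card_V_ge d_ge by simp

section \<open>Bridges and unilateral orientations\<close>

lemma boundary_Compl:
  assumes "boundary C = {(t, s)}"
  shows "boundary (V - C) = {(s, t)}"
proof -
  have "(a, b) \<in> boundary (V - C) \<longleftrightarrow> (b, a) \<in> boundary C" for a b
    using R_V sym_R[of a b] sym_R[of b a] by (auto simp: boundary_def)
  then show ?thesis using assms by auto
qed

text \<open>The far side \<open>V - C\<close> and two branches have at least \<open>2 * d\<close>
  vertices each, which leaves fewer than \<open>2 * d\<close> for \<open>T\<close>. A third branch
  no longer fits, so at most three edges leave \<open>T\<close>; with \<open>4 \<le> d\<close> this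
  forces \<open>T\<close> to have \<open>2 * d\<close> vertices after all.\<close>

lemma at_most_one_branch:
  assumes T: "maximal_strong C t T" and C: "C \<subseteq> V" "boundary C = {(t, s)}"
    and f: "(x, y) \<in> R" "x \<in> T" "y \<in> C - T"
    and g: "(x', y') \<in> R" "x' \<in> T" "y' \<in> C - T"
  shows "(x, y) = (x', y')"
proof (rule ccontr)
  assume ne: "(x, y) \<noteq> (x', y')"
  define K where "K = branch (C - T)"
  have bC: "boundary C \<subseteq> {t} \<times> UNIV" using C by auto
  have TC: "T \<subseteq> C" "t \<in> T" "T \<subseteq> V"
    using T by (auto simp: maximal_strong_def strongly_orientable_def)
  have bK: "boundary (K b) = {(b, a)}" "K b \<subseteq> C - T" "b \<in> K b"
    if "(a, b) \<in> R" "a \<in> T" "b \<in> C - T" for a b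
    using boundary_branch[OF T C(1) bC] branch_subset[of b "C - T"] that
    by (auto simp: K_def branch_def)
  have large: "2 * d \<le> card (K b)" if "(a, b) \<in> R" "a \<in> T" "b \<in> C - T" for a b
    by (rule card_ge_if_bridge[of _ "(b, a)"]) (use bK[OF that] C in auto)
  \<comment> \<open>A branch determines its attaching edge through its singleton boundary, so
    different edges have different, hence disjoint, branches.\<close>
  have disj: "K b \<inter> K b' = {}"
    if "(a, b) \<in> R" "a \<in> T" "b \<in> C - T" "(a', b') \<in> R" "a' \<in> T" "b' \<in> C - T"
      "(a, b) \<noteq> (a', b')" for a b a' b'
  proof (rule ccontr)
    assume "K b \<inter> K b' \<noteq> {}"
    then have "K b = K b'" unfolding K_def by (rule branch_eq_if_meet)
    then have "{(b, a)} = {(b', a')}" using bK(1)[OF that(1-3)] bK(1)[OF that(4-6)] by metis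
    then show False using that(7) by simp
  qed
  have finC: "finite C" using C finite_V finite_subset by blast
  have s: "s \<in> V - C" using C R_V by (auto simp: boundary_def)
  have out: "2 * d \<le> card (V - C)"
    by (rule card_ge_if_bridge[OF _ _ boundary_Compl[OF C(2)]]) (use s in auto)
  have split: "card V = card (V - C) + card C"
    using C finite_V by (simp add: card_Diff_subset card_mono finC)
  have "card (K y) + card (K y') + card T \<le> card C"
    by (rule card_three_disjoint_le) (use finC disj[OF f g ne] bK[OF f] bK[OF g] TC in auto)
  \<comment> \<open>With \<open>T\<close> nonempty, \<open>6 * d + 1 \<le> card V\<close> and
    \<open>card V + 6 \<le> 8 * d\<close> yield \<open>4 \<le> d\<close>.\<close>
  moreover have "0 < card T" using TC finC finite_subset by (auto simp: card_gt_0_iff)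
  ultimately have d4: "4 \<le> d" and T_small: "card T < 2 * d"
    using large[OF f] large[OF g] out split d_ge by linarith+
  have "boundary T \<subseteq> {(t, s), (x, y), (x', y')}"
  proof
    fix e assume "e \<in> boundary T"
    then obtain a b where e: "e = (a, b)" "(a, b) \<in> R" "a \<in> T" "b \<notin> T"
      by (auto simp: boundary_def)
    show "e \<in> {(t, s), (x, y), (x', y')}"
    proof (cases "b \<in> C")
      case False
      then have "(a, b) \<in> boundary C" using e TC by (auto simp: boundary_def)
      then show ?thesis using C e by auto
    next
      case True
      then have h: "(a, b) \<in> R" "a \<in> T" "b \<in> C - T" using e by auto
      show ?thesis
      proof (rule ccontr)
        assume "e \<notin> {(t, s), (x, y), (x', y')}"
        then have ne': "(a, b) \<noteq> (x, y)" "(a, b) \<noteq> (x', y')" using e by auto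
        have "card (K b) + card (K y) + card (K y') \<le> card C"
          by (rule card_three_disjoint_le)
            (use finC disj[OF f g ne] disj[OF h f ne'(1)] disj[OF h g ne'(2)]
              bK(2)[OF f] bK(2)[OF g] bK(2)[OF h] in auto)
        then show False
          using large[OF f] large[OF g] large[OF h] out split d_ge by linarith
      qed
    qed
  qed
  then have "card (boundary T) \<le> card {(t, s), (x, y), (x', y')}"
    by (rule card_mono[rotated]) simp
  also have "\<dots> \<le> 3" by (simp add: card_insert_if)
  finally have "2 * d \<le> card T"
    using d4 TC by (intro card_ge_if_small_boundary) auto
  then show False using T_small by simp
qed

text \<open>Induction peels off a maximal strong part \<open>T\<close> at the inner end of the
  bridge. What remains is empty or a single branch hanging on one bridge; that bridge is directed
  away from \<open>T\<close>, and the branch is oriented from its own root \<open>y\<close>.\<close>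

lemma unilaterally_orientable_if_bridge:
  assumes "C \<subseteq> V" "boundary C = {(t, s)}"
  shows "unilaterally_orientable t C"
  using assms
proof (induction "card C" arbitrary: C t s rule: less_induct)
  case less
  note C = less.prems
  have tC: "t \<in> C" using C by (auto simp: boundary_def)
  obtain T where T: "maximal_strong C t T" using maximal_strong_exists tC C by blast
  then have TC: "T \<subseteq> C" "t \<in> T" "T \<subseteq> V" and sT: "strongly_orientable t T"
    by (auto simp: maximal_strong_def strongly_orientable_def)
  \<comment> \<open>By connectedness some edge leaves \<open>S\<close>. It can end neither in the
    rest of \<open>C - T\<close> nor outside \<open>C\<close>, since the only edge out of
    \<open>C\<close> starts at \<open>t\<close> in \<open>T\<close>.\<close>
  have exits: "\<exists>a b. (a, b) \<in> R \<and> a \<in> T \<and> b \<in> S" if S: "S \<subseteq> C - T" "S \<noteq> {}"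
      and closed: "boundary S \<inter> S \<times> (C - T) = {}" for S
  proof -
    have "boundary S \<noteq> {}" by (rule boundary_nonempty) (use S C TC in auto)
    then obtain b a where ab: "(b, a) \<in> R" "b \<in> S" "a \<notin> S" by (auto simp: boundary_def)
    have "a \<in> C"
    proof (rule ccontr)
      assume "a \<notin> C"
      then have "(b, a) \<in> boundary C" using ab S by (auto simp: boundary_def)
      then show False using C ab S TC by auto
    qed
    then show ?thesis using ab S closed sym_R by (auto simp: boundary_def)
  qed
  show ?case
  proof (cases "T = C")
    case True
    then show ?thesis using sT unilaterally_orientable_if_strongly by blast
  next
    case False
    then obtain x y where f: "(x, y) \<in> R" "x \<in> T" "y \<in> C - T"
      using exits[of "C - T"] TC by (auto simp: boundary_def)
    define K where "K = branch (C - T) y"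
    have bK: "boundary K = {(y, x)}" unfolding K_def
      by (rule boundary_branch[OF T C(1)]) (use C f in auto)
    have KC: "K \<subseteq> C - T" unfolding K_def by (rule branch_subset) (rule f)
    have yK: "y \<in> K" by (simp add: K_def branch_def)
    \<comment> \<open>Vertices outside the branch would supply a second edge from \<open>T\<close>,
      ending outside \<open>K\<close> and so different from \<open>(x, y)\<close>.\<close>
    have "C - T - K = {}"
    proof (rule ccontr)
      assume ne: "C - T - K \<noteq> {}"
      have "boundary (C - T - K) \<inter> (C - T - K) \<times> (C - T) = {}"
      proof -
        have False if "(b, a) \<in> R" "b \<in> C - T - K" "a \<in> K" for a b
        proof -
          have "(a, b) \<in> boundary K" using that sym_R[OF that(1)] by (simp add: boundary_def)
          then show False using bK f(2) that(2) by simp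
        qed
        then show ?thesis by (fastforce simp: boundary_def)
      qed
      then obtain a b where "(a, b) \<in> R" "a \<in> T" "b \<in> C - T - K"
        using exits[of "C - T - K"] ne by blast
      then show False using at_most_one_branch[OF T C, of a b x y] f yK by auto
    qed
    then have CTK: "C = T \<union> K" "T \<inter> K = {}" using KC TC by auto
    have "K \<subset> C" using CTK TC by auto
    then have "card K < card C"
      using C finite_V by (meson finite_subset psubset_card_mono)
    then have "unilaterally_orientable y K"
      using less.hyps[of K y x] bK \<open>K \<subset> C\<close> C by auto
    then obtain D' where D': "orientation K D'" "\<And>z. z \<in> K \<Longrightarrow> (y, z) \<in> D'\<^sup>*"
      "\<And>u v. u \<in> K \<Longrightarrow> v \<in> K \<Longrightarrow> (u, v) \<in> D'\<^sup>* \<or> (v, u) \<in> D'\<^sup>*"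
      unfolding unilaterally_orientable_def by blast
    obtain D where D: "orientation T D" "\<And>z. z \<in> T \<Longrightarrow> (t, z) \<in> D\<^sup>* \<and> (z, t) \<in> D\<^sup>*"
      using sT unfolding strongly_orientable_def by blast
    define A where "A = insert (x, y) (D \<union> D')"
    have mono: "D\<^sup>* \<subseteq> A\<^sup>*" "D'\<^sup>* \<subseteq> A\<^sup>*" by (rule rtrancl_mono; auto simp: A_def)+
    have "orientation C A"
      unfolding A_def CTK(1) using D(1) D'(1) CTK(2) f yK by (intro orientation_join) auto
    \<comment> \<open>The route goes from \<open>u\<close> to the root \<open>t\<close>; a target in
      \<open>K\<close> is then reached through \<open>x\<close>, the bridge and
      \<open>y\<close>.\<close>
    moreover have TK: "(u, v) \<in> A\<^sup>*" if "u \<in> T" "v \<in> C" for u v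
    proof -
      have ut: "(u, t) \<in> A\<^sup>*" "(t, x) \<in> A\<^sup>*" using D(2) that f mono by auto
      show ?thesis
      proof (cases "v \<in> T")
        case True
        then have "(t, v) \<in> A\<^sup>*" using D(2) mono by auto
        then show ?thesis using ut by (meson rtrancl_trans)
      next
        case False
        then have "(y, v) \<in> A\<^sup>*" using D'(2) that CTK mono by auto
        moreover have "(x, y) \<in> A" by (simp add: A_def)
        ultimately show ?thesis using ut by (meson converse_rtrancl_into_rtrancl rtrancl_trans)
      qed
    qed
    moreover have "(u, v) \<in> A\<^sup>* \<or> (v, u) \<in> A\<^sup>*" if "u \<in> C" "v \<in> C" for u v
      using that TK[of u v] TK[of v u] D'(3)[of u v] CTK mono by blast
    ultimately show ?thesis using TC unfolding unilaterally_orientable_def by blast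
  qed
qed

text \<open>If a maximal strong part is not everything, an edge leaving it is a bridge. Each side is
  oriented from its own end of the bridge, and one side is then reversed, so that it drains into the
  bridge and on to the other side.\<close>

theorem unilateral_orientation_exists:
  "\<exists>D. orientation V D \<and> (\<forall>u\<in>V. \<forall>v\<in>V. (u, v) \<in> D\<^sup>* \<or> (v, u) \<in> D\<^sup>*)"
proof -
  obtain t where "t \<in> V" using card_V_ge by fastforce
  then obtain T where T: "maximal_strong V t T" using maximal_strong_exists by blast
  then have TV: "T \<subseteq> V" "t \<in> T" and sT: "strongly_orientable t T"
    by (auto simp: maximal_strong_def strongly_orientable_def)
  show ?thesis
  proof (cases "T = V")
    case True
    then show ?thesis using unilaterally_orientable_if_strongly[OF sT]
      unfolding unilaterally_orientable_def by blast
  next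
    case False
    then have "boundary T \<noteq> {}" using TV by (intro boundary_nonempty) auto
    then obtain x y where f: "x \<in> T" "(x, y) \<in> R" "y \<in> V - T"
      using R_V by (auto simp: boundary_def)
    define K where "K = branch (V - T) y"
    \<comment> \<open>Here \<open>C\<close> is \<open>V\<close>, whose boundary is empty.\<close>
    have bK: "boundary K = {(y, x)}" unfolding K_def
      by (rule boundary_branch[OF T]) (use f R_V in \<open>auto simp: boundary_def\<close>)
    have KV: "K \<subseteq> V" using branch_subset[OF f(3)] by (auto simp: K_def)
    obtain D where D: "orientation K D" "\<And>z. z \<in> K \<Longrightarrow> (y, z) \<in> D\<^sup>*"
      "\<And>u v. u \<in> K \<Longrightarrow> v \<in> K \<Longrightarrow> (u, v) \<in> D\<^sup>* \<or> (v, u) \<in> D\<^sup>*"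
      using unilaterally_orientable_if_bridge[OF KV bK]
      unfolding unilaterally_orientable_def by blast
    obtain D' where D': "orientation (V - K) D'" "\<And>z. z \<in> V - K \<Longrightarrow> (x, z) \<in> D'\<^sup>*"
      "\<And>u v. u \<in> V - K \<Longrightarrow> v \<in> V - K \<Longrightarrow> (u, v) \<in> D'\<^sup>* \<or> (v, u) \<in> D'\<^sup>*"
      using unilaterally_orientable_if_bridge[OF _ boundary_Compl[OF bK]]
      unfolding unilaterally_orientable_def by blast
    have xy: "y \<in> K" "x \<in> V - K" using bK f R_V by (auto simp: boundary_def)
    \<comment> \<open>In \<open>D'\<close> the vertex \<open>x\<close> reaches its whole side; in
      the converse that side reaches \<open>x\<close>.\<close>
    define A where "A = insert (x, y) (D'\<inverse> \<union> D)"
    have mono: "(D'\<inverse>)\<^sup>* \<subseteq> A\<^sup>*" "D\<^sup>* \<subseteq> A\<^sup>*" by (rule rtrancl_mono; auto simp: A_def)+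
    have "orientation (V - K \<union> K) A"
      unfolding A_def using D(1) D'(1) f xy
      by (intro orientation_join orientation_converse) auto
    then have "orientation V A" using KV by (simp add: Un_absorb2)
    moreover have cross: "(u, v) \<in> A\<^sup>*" if "u \<in> V - K" "v \<in> K" for u v
    proof -
      have "(u, x) \<in> (D'\<inverse>)\<^sup>*" using D'(2)[OF that(1)] by (simp add: rtrancl_converse)
      then have "(u, x) \<in> A\<^sup>*" using mono by blast
      moreover have "(x, y) \<in> A" by (simp add: A_def)
      moreover have "(y, v) \<in> A\<^sup>*" using D(2)[OF that(2)] mono by blast
      ultimately show ?thesis by (meson converse_rtrancl_into_rtrancl rtrancl_trans)
    qed
    moreover have "(u, v) \<in> A\<^sup>* \<or> (v, u) \<in> A\<^sup>*" if "u \<in> V" "v \<in> V" for u v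
    proof -
      have "(u, v) \<in> A\<^sup>* \<or> (v, u) \<in> A\<^sup>*" if "u \<in> V - K" "v \<in> V - K"
        using D'(3)[OF that] mono by (auto simp: rtrancl_converse)
      then show ?thesis
        using that cross[of u v] cross[of v u] D(3)[of u v] mono by blast
    qed
    ultimately show ?thesis by blast
  qed
qed

end

section \<open>From directed walks to proper paths\<close>

lemma path_edges_simps [simp]:
  "path_edges [] = []" "path_edges [a] = []"
  "path_edges (a # b # p) = {a, b} # path_edges (b # p)"
  by (simp_all add: path_edges_def)

lemma is_path_imp_rtrancl:
  assumes "is_path V E u p v"
  shows "(u, v) \<in> {(a, b). {a, b} \<in> E}\<^sup>*"
proof -
  have "(hd p, last p) \<in> {(a, b). {a, b} \<in> E}\<^sup>*" if "set (path_edges p) \<subseteq> E" "p \<noteq> []"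
    using that
    by (induction p rule: induct_list012) (auto intro: converse_rtrancl_into_rtrancl)
  then show ?thesis using assms by (auto simp: is_path_def)
qed

text \<open>Stated for an arbitrary relation so that it serves both an orientation and its
  converse.\<close>

lemma proper_path_if_rtrancl:
  assumes "(u, v) \<in> R\<^sup>*" "u \<in> V"
    and edge: "\<And>a b. (a, b) \<in> R \<Longrightarrow> {a, b} \<in> E \<and> b \<in> V"
    and alternate: "\<And>a b d. (a, b) \<in> R \<Longrightarrow> (b, d) \<in> R \<Longrightarrow> c {a, b} \<noteq> c {b, d}"
  shows "\<exists>p. proper_path V E c u p v"
proof -
  obtain p where p: "p \<noteq> []" "hd p = u" "last p = v" "distinct p"
    "successively (\<lambda>a b. (a, b) \<in> R) p"
    using rtrancl_imp_distinct_path[OF assms(1)] by blast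
  have "set p \<subseteq> V \<and> set (path_edges p) \<subseteq> E \<and>
      successively (\<lambda>e f. c e \<noteq> c f) (path_edges p)"
    if "successively (\<lambda>a b. (a, b) \<in> R) p" "hd p \<in> V" for p
    using that
  proof (induction p rule: induct_list012)
    case (3 a b q)
    then show ?case using edge[of a b] alternate[of a b] by (cases q) auto
  qed auto
  with p assms(2) show ?thesis
    by (intro exI[of _ p]) (auto simp: proper_path_def is_path_def)
qed

text \<open>Two consecutive edges would need different colours, so the path is a single edge. This
  excludes one colour in the lower bound.\<close>

lemma adjacent_if_monochromatic:
  assumes "proper_path V E c u p v" "u \<noteq> v"
    and mono: "\<And>e f. e \<in> E \<Longrightarrow> f \<in> E \<Longrightarrow> c e = c f"
  shows "{u, v} \<in> E"
proof -
  have p: "hd p = u" "last p = v" "p \<noteq> []" "set (path_edges p) \<subseteq> E"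
    "successively (\<lambda>e f. c e \<noteq> c f) (path_edges p)"
    using assms(1) by (auto simp: proper_path_def is_path_def)
  obtain a b q where q: "p = a # b # q"
    using p(1-3) assms(2) by (metis last.simps list.exhaust_sel)
  show ?thesis
  proof (cases q)
    case Nil
    then show ?thesis using p q by auto
  next
    case (Cons d r)
    then have "c {a, b} \<noteq> c {b, d}" "{a, b} \<in> E" "{b, d} \<in> E"
      using p(4,5) q by (auto simp: successively_Cons)
    then show ?thesis using mono by metis
  qed
qed

lemma card_neighbours_eq_degree:
  assumes "simple_graph V E"
  shows "card ({(a, b). {a, b} \<in> E} `` {v}) = degree E v"
proof -
  have "bij_betw (\<lambda>b. {v, b}) ({(a, b). {a, b} \<in> E} `` {v}) {e \<in> E. v \<in> e}"
    unfolding bij_betw_def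
  proof
    show "inj_on (\<lambda>b. {v, b}) ({(a, b). {a, b} \<in> E} `` {v})"
      by (auto simp: inj_on_def doubleton_eq_iff)
    have "\<exists>b. e = {v, b}" if "e \<in> E" "v \<in> e" for e
    proof -
      have "card e = 2" using assms that by (auto simp: simple_graph_def)
      then show ?thesis using that(2) by (auto simp: card_2_iff)
    qed
    then show "(\<lambda>b. {v, b}) ` ({(a, b). {a, b} \<in> E} `` {v}) = {e \<in> E. v \<in> e}"
      by auto
  qed
  then show ?thesis unfolding degree_def by (rule bij_betw_same_card)
qed

section \<open>The proper connection number: two colours suffice and one does not\<close>

theorem theorem9:
  fixes V :: "'a set" and E :: "'a set set"
  assumes "simple_graph V E"
    and "connected_graph V E"
    and "bipartite V E"
    and "card V \<ge> 4"
    and "real (min_degree V E) \<ge> (real (card V) + 6) / 8"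
  shows "proper_connection_number V E = 2"
proof -
  define R where "R = {(a, b). {a, b} \<in> E}"
  obtain X Y where XY: "X \<union> Y = V" "X \<inter> Y = {}"
    and E: "\<forall>e\<in>E. \<exists>x\<in>X. \<exists>y\<in>Y. e = {x, y}"
    using assms(3) by (auto simp: bipartite_def)
  have fin: "finite V" using assms(1) by (simp add: simple_graph_def)
  have finE: "finite E"
    by (rule finite_subset[of _ "Pow V"]) (use assms(1) fin in \<open>auto simp: simple_graph_def\<close>)
  have RXY: "R \<subseteq> X \<times> Y \<union> Y \<times> X"
  proof clarify
    fix a b assume "(a, b) \<in> R" "\<not> (a \<in> Y \<and> b \<in> X)"
    moreover from this obtain x y where "x \<in> X" "y \<in> Y" "{a, b} = {x, y}"
      using E by (auto simp: R_def)
    ultimately show "a \<in> X \<and> b \<in> Y" by (auto simp: doubleton_eq_iff)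
  qed
  interpret dense_bipartite V X Y R "min_degree V E"
  proof
    show "(u, v) \<in> R\<^sup>*" if "u \<in> V" "v \<in> V" for u v
      using assms(2) that is_path_imp_rtrancl unfolding connected_graph_def R_def by metis
    show "min_degree V E \<le> card (R `` {v})" if "v \<in> V" for v
      using that fin unfolding R_def card_neighbours_eq_degree[OF assms(1)] min_degree_def by simp
    have "real (card V + 6) \<le> real (8 * min_degree V E)" using assms(5) by simp
    then show "card V + 6 \<le> 8 * min_degree V E" by linarith
  qed (use fin XY RXY assms(4) in \<open>auto simp: R_def insert_commute\<close>)
  obtain D where D: "orientation V D"
    "\<And>u v. u \<in> V \<Longrightarrow> v \<in> V \<Longrightarrow> (u, v) \<in> D\<^sup>* \<or> (v, u) \<in> D\<^sup>*"
    using unilateral_orientation_exists by blast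
  have DR: "(a, b) \<in> D \<Longrightarrow> (a, b) \<in> R \<and> (b, a) \<notin> D" for a b
    using D(1) by (auto simp: orientation_def)
  \<comment> \<open>Edges without a direction share colour 1 with those directed from
    \<open>Y\<close> to \<open>X\<close>; the paths constructed below follow only edges of
    \<open>D\<close>.\<close>
  define c :: "'a set \<Rightarrow> nat"
    where "c e = (if \<exists>x\<in>X. \<exists>y\<in>Y. e = {x, y} \<and> (x, y) \<in> D then 0 else 1)" for e
  have c: "c {x, y} = (if (x, y) \<in> D then 0 else 1)" if "x \<in> X" "y \<in> Y" for x y
    using that XY by (auto simp: c_def doubleton_eq_iff)
  \<comment> \<open>Since \<open>a\<close> and \<open>d\<close> lie in the same class, one arc runs
    from \<open>X\<close> to \<open>Y\<close> and the other from \<open>Y\<close> to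
    \<open>X\<close>.\<close>
  have alternate: "c {a, b} \<noteq> c {b, d}" if "(a, b) \<in> D" "(b, d) \<in> D" for a b d
  proof (cases "a \<in> X")
    case True
    then have "b \<in> Y" "d \<in> X" using DR[OF that(1)] DR[OF that(2)] RXY XY by auto
    then show ?thesis using True c[of a b] c[of d b] that DR by (simp add: insert_commute)
  next
    case False
    then have "a \<in> Y" "b \<in> X" "d \<in> Y" using DR[OF that(1)] DR[OF that(2)] RXY XY by auto
    then show ?thesis using c[of b a] c[of b d] that DR by (simp add: insert_commute)
  qed
  have "\<exists>p. proper_path V E c u p v" if "u \<in> V" "v \<in> V" for u v
    using D(2)[OF that]
  proof
    assume "(u, v) \<in> D\<^sup>*"
    then show ?thesis
      by (rule proper_path_if_rtrancl) (use that DR R_V alternate in \<open>auto simp: R_def\<close>)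
  next
    assume "(v, u) \<in> D\<^sup>*"
    \<comment> \<open>Colours belong to undirected edges, so a path traversed against its arcs
      alternates as well.\<close>
    then have "(u, v) \<in> (D\<inverse>)\<^sup>*" by (simp add: rtrancl_converse)
    then show ?thesis
    proof (rule proper_path_if_rtrancl)
      show "{a, b} \<in> E \<and> b \<in> V" if "(a, b) \<in> D\<inverse>" for a b
        using that DR[of b a] R_V by (auto simp: R_def insert_commute)
      show "c {a, b} \<noteq> c {b, d}" if "(a, b) \<in> D\<inverse>" "(b, d) \<in> D\<inverse>" for a b d
        using that alternate[of d b a] by (auto simp: insert_commute)
    qed (rule that)
  qed
  then have good: "proper_connected_coloring V E c" by (auto simp: proper_connected_coloring_def)
  \<comment> \<open>Four vertices put at least two into one class, and these are not
    adjacent.\<close>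
  obtain u v where uv: "u \<in> V" "v \<in> V" "u \<noteq> v" "(u, v) \<notin> R"
  proof -
    have "card V \<le> card X + card Y" using XY card_Un_le by metis
    then have "2 \<le> card X \<or> 2 \<le> card Y" using assms(4) by linarith
    then obtain Z where Z: "2 \<le> card Z" "Z = X \<or> Z = Y" by blast
    then have "finite Z" "\<not> card Z \<le> Suc 0" using fin XY by auto
    then obtain u v where "u \<in> Z" "v \<in> Z" "u \<noteq> v"
      using card_le_Suc0_iff_eq[of Z] by blast
    with Z show thesis using that[of u v] XY RXY by auto
  qed
  have two_le: "2 \<le> card (c' ` E)" if c': "proper_connected_coloring V E c'"
    for c' :: "'a set \<Rightarrow> nat"
  proof (rule ccontr)
    assume "\<not> 2 \<le> card (c' ` E)"
    then have "card (c' ` E) \<le> Suc 0" by simp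
    then have "c' e = c' f" if "e \<in> E" "f \<in> E" for e f
      using that card_le_Suc0_iff_eq[of "c' ` E"] finE by blast
    moreover obtain p where "proper_path V E c' u p v"
      using c' uv by (auto simp: proper_connected_coloring_def)
    ultimately have "{u, v} \<in> E" using adjacent_if_monochromatic uv(3) by metis
    then show False using uv(4) by (simp add: R_def)
  qed
  have "card (c ` E) \<le> card {0, 1 :: nat}" by (rule card_mono) (auto simp: c_def)
  then have "card (c ` E) = 2" using two_le[OF good] by simp
  then show ?thesis unfolding proper_connection_number_def
    using good two_le by (intro Least_equality) auto
qed

end
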